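(* Let $p$ be an odd prime and let $$G_4=\langle x,y,z,w \mid x^p=y^p=z^p=w^p=1,\ [x,y]=z,\ [x,z]=[x,w]=[y,z]=[y,w]=[z,w]=1\rangle.$$ Then no central extension of $G_4$ is an exceptional group of order $p^5$ with distinguished quotient isomorphic to $G_4$; that is, there is no group $E$ of order $p^5$ having a central subgroup $N$ such that $E/N\cong G_4$ and $\mu(E)<\mu(E/N)$.
   Context: All groups are finite. The minimal degree $\mu(G)$ of a group $G$ is the least non-negative integer $n$ such that $G$ embeds in the symmetric group $\mathrm{Sym}(n)$. A group $G$ is called exceptional if it has a normal subgroup $N$ such that $\mu(G)<\mu(G/N)$; in this case $N$ is called a distinguished subgroup and $G/N$ a distinguished quotient of $G$. Commutators are $[a,b]=a^{-1}b^{-1}ab$. *)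

theory Defs
  imports "HOL-Algebra.Sym_Groups" "HOL-Computational_Algebra.Primes"
begin

section \<open>Free groups and presentations\<close>

text \<open>The letter \<open>(g, True)\<close> stands for the generator \<open>g\<close> and \<open>(g, False)\<close> for its inverse.\<close>

type_synonym 'g word = "('g \<times> bool) list"

inductive word_eq :: "'g word \<Rightarrow> 'g word \<Rightarrow> bool" where
  cancel: "word_eq (u @ (g, b) # (g, \<not> b) # v) (u @ v)"
| refl: "word_eq u u"
| sym: "word_eq u v \<Longrightarrow> word_eq v u"
| trans: "word_eq u v \<Longrightarrow> word_eq v w \<Longrightarrow> word_eq u w"

definition word_rel :: "('g word \<times> 'g word) set" where
  "word_rel = {(u, v). word_eq u v}"

definition free_group :: "'g word set monoid" where
  "free_group = \<lparr>carrier = UNIV // word_rel,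
                 monoid.mult = (\<lambda>A B. \<Union>u\<in>A. \<Union>v\<in>B. word_rel `` {u @ v}),
                 one = word_rel `` {[]}\<rparr>"

definition free_gen :: "'g \<Rightarrow> 'g word set" where
  "free_gen g = word_rel `` {[(g, True)]}"

definition normal_closure :: "('a, 'b) monoid_scheme \<Rightarrow> 'a set \<Rightarrow> 'a set" where
  "normal_closure G S = \<Inter>{H. H \<lhd> G \<and> S \<subseteq> H}"

text \<open>A pair \<open>(u, v)\<close> of elements of the free group encodes the defining relation \<open>u = v\<close>.\<close>

definition presented_group :: "('g word set \<times> 'g word set) set \<Rightarrow> 'g word set set monoid" where
  "presented_group R =
     free_group Mod normal_closure free_group {u \<otimes>\<^bsub>free_group\<^esub> inv\<^bsub>free_group\<^esub> v | u v. (u, v) \<in> R}"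

lemma equiv_word_rel: "equiv UNIV word_rel"
  by (auto simp: equiv_def refl_on_def sym_def trans_def word_rel_def intro: word_eq.intros)

lemma word_eq_append1: "word_eq u v \<Longrightarrow> word_eq (w @ u) (w @ v)"
proof (induction rule: word_eq.induct)
  case (cancel u g b v)
  then show ?case using word_eq.cancel[of "w @ u"] by simp
qed (auto intro: word_eq.intros)

lemma word_eq_append2: "word_eq u v \<Longrightarrow> word_eq (u @ w) (v @ w)"
proof (induction rule: word_eq.induct)
  case (cancel u g b v)
  then show ?case using word_eq.cancel[of u g b "v @ w"] by simp
qed (auto intro: word_eq.intros)

lemma free_group_mult_class:
  fixes u v :: "'g word"
  shows "word_rel `` {u} \<otimes>\<^bsub>free_group\<^esub> word_rel `` {v} = word_rel `` {u @ v}"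
proof -
  have app: "word_eq (a @ c) (b @ d)" if "word_eq a b" "word_eq c d" for a b c d :: "'g word"
    using word_eq.trans[OF word_eq_append2[OF that(1)] word_eq_append1[OF that(2)]] .
  have "congruent2 word_rel word_rel (\<lambda>u v :: 'g word. word_rel `` {u @ v})"
  proof (rule congruent2I')
    fix a b c d :: "'g word"
    assume "(a, b) \<in> word_rel" "(c, d) \<in> word_rel"
    then have "(a @ c, b @ d) \<in> word_rel" by (simp add: word_rel_def app)
    then show "word_rel `` {a @ c} = word_rel `` {b @ d}"
      by (rule equiv_class_eq[OF equiv_word_rel])
  qed
  then show ?thesis
    using UN_equiv_class2[OF equiv_word_rel equiv_word_rel] by (simp add: free_group_def)
qed

lemma free_group_one: "\<one>\<^bsub>free_group\<^esub> = word_rel `` {[]}"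
  by (simp add: free_group_def)

lemma free_group_class_closed: "word_rel `` {u} \<in> carrier free_group"
  by (auto simp: free_group_def quotient_def)

lemma free_group_carrierE:
  assumes "A \<in> carrier free_group"
  obtains u where "A = word_rel `` {u}"
  using assms by (auto simp: free_group_def quotient_def)

lemma word_eq_inverse: "word_eq (rev (map (\<lambda>(g, b). (g, \<not> b)) u) @ u) []"
proof (induction u)
  case Nil
  then show ?case by (simp add: word_eq.refl)
next
  case (Cons a u)
  obtain g b where a: "a = (g, b)" by force
  have "word_eq (rev (map (\<lambda>(g, b). (g, \<not> b)) u) @ (g, \<not> b) # (g, \<not> \<not> b) # u)
                (rev (map (\<lambda>(g, b). (g, \<not> b)) u) @ u)"
    by (rule word_eq.cancel)
  with Cons show ?case by (simp add: a) (blast intro: word_eq.trans)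
qed

lemma group_free_group: "group free_group"
proof (rule groupI)
  fix A assume "A \<in> carrier free_group"
  then obtain u where A: "A = word_rel `` {u}" by (rule free_group_carrierE)
  have "word_rel `` {rev (map (\<lambda>(g, b). (g, \<not> b)) u) @ u} = word_rel `` {[]}"
    by (rule equiv_class_eq[OF equiv_word_rel]) (simp add: word_rel_def word_eq_inverse)
  then show "\<exists>B\<in>carrier free_group. B \<otimes>\<^bsub>free_group\<^esub> A = \<one>\<^bsub>free_group\<^esub>"
    unfolding A free_group_one
    by (intro bexI[OF _ free_group_class_closed]) (simp add: free_group_mult_class)
qed (auto elim!: free_group_carrierE
      simp: free_group_mult_class free_group_one free_group_class_closed)

section \<open>Minimal degree and distinguished subgroups\<close>

definition minimal_degree :: "('a, 'b) monoid_scheme \<Rightarrow> nat" where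
  "minimal_degree G = (LEAST n. \<exists>f. f \<in> mon G (sym_group n))"

definition distinguished_subgroup :: "('a, 'b) monoid_scheme \<Rightarrow> 'a set \<Rightarrow> bool" where
  "distinguished_subgroup G N \<longleftrightarrow>
     group G \<and> finite (carrier G) \<and> N \<lhd> G \<and> minimal_degree G < minimal_degree (G Mod N)"

definition exceptional_group :: "('a, 'b) monoid_scheme \<Rightarrow> bool" where
  "exceptional_group G \<longleftrightarrow> (\<exists>N. distinguished_subgroup G N)"

definition central_subgroup :: "('a, 'b) monoid_scheme \<Rightarrow> 'a set \<Rightarrow> bool" where
  "central_subgroup G N \<longleftrightarrow>
     subgroup N G \<and> (\<forall>n\<in>N. \<forall>g\<in>carrier G. n \<otimes>\<^bsub>G\<^esub> g = g \<otimes>\<^bsub>G\<^esub> n)"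

section \<open>The group \<open>G\<^sub>4\<close>\<close>

definition commutator :: "('a, 'b) monoid_scheme \<Rightarrow> 'a \<Rightarrow> 'a \<Rightarrow> 'a" where
  "commutator G a b = inv\<^bsub>G\<^esub> a \<otimes>\<^bsub>G\<^esub> inv\<^bsub>G\<^esub> b \<otimes>\<^bsub>G\<^esub> a \<otimes>\<^bsub>G\<^esub> b"

datatype gen = gen_x | gen_y | gen_z | gen_w

definition G4 :: "nat \<Rightarrow> gen word set set monoid" where
  "G4 p =
    (let F = free_group; e = \<one>\<^bsub>F\<^esub>;
         x = free_gen gen_x; y = free_gen gen_y; z = free_gen gen_z; w = free_gen gen_w
     in presented_group
       {(x [^]\<^bsub>F\<^esub> p, e), (y [^]\<^bsub>F\<^esub> p, e), (z [^]\<^bsub>F\<^esub> p, e), (w [^]\<^bsub>F\<^esub> p, e),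
        (commutator F x y, z),
        (commutator F x z, e), (commutator F x w, e), (commutator F y z, e),
        (commutator F y w, e), (commutator F z w, e)})"

end

theory Submission
  imports Defs "HOL-Algebra.Group_Action" "HOL-Algebra.Zassenhaus"
begin

text \<open>
  The group \<open>G\<^sub>4\<close> is the direct product of the Heisenberg group over the field with \<open>p\<close>
  elements and a cyclic group of order \<open>p\<close>. It acts faithfully on \<open>p\<^sup>2 + p\<close> points, so
  \<open>\<mu>(G\<^sub>4) \<le> p\<^sup>2 + p\<close>, and it has only \<open>p\<close> commutators. Hence it is enough to show that a group
  \<open>E\<close> of order \<open>p\<^sup>5\<close> with a central subgroup \<open>N\<close> of order \<open>p\<close> and \<open>E/N \<cong> G\<^sub>4\<close> has no
  faithful permutation representation of degree \<open>n < p\<^sup>2 + p\<close>. Note that \<open>E\<close> has at most \<open>p\<^sup>2\<close>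
  commutators, since they lie in \<open>p\<close> cosets of \<open>N\<close>.

  In such a representation every orbit has length \<open>1\<close>, \<open>p\<close> or \<open>p\<^sup>2\<close>, and an orbit of length
  \<open>p\<^sup>2\<close> leaves fewer than \<open>p\<close> points, all of them fixed. This gives two cases
  (\<open>small_degree_dichotomy\<close>).

  If no orbit has length \<open>p\<^sup>2\<close>, all point stabilizers have index \<open>1\<close> or \<open>p\<close>. In a \<open>p\<close>-group
  they all contain the commutators (\<open>commutator_in_index_prime\<close>), so \<open>E\<close> is abelian, whereas
  \<open>G\<^sub>4\<close> is not.

  If some orbit has length \<open>p\<^sup>2\<close>, its point stabilizer \<open>H\<close> has order \<open>p\<^sup>3\<close> and contains no
  non-trivial normal subgroup of \<open>E\<close>. Then \<open>M = NH\<close> has index \<open>p\<close>, so it is normal, and its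
  commutators are those of \<open>H\<close>, which therefore generate a normal subgroup inside \<open>H\<close>: \<open>M\<close> is
  abelian. For \<open>t \<notin> M\<close> no non-trivial element of \<open>H\<close> commutes with \<open>t\<close>, because it would be
  central. Consequently the \<open>p\<^sup>3\<close> commutators \<open>[h, t]\<close> with \<open>h \<in> H\<close> are distinct
  (\<open>core_free_imp_many_commutators\<close>), which is more than \<open>p\<^sup>2\<close>.

  The presentation is compared with the concrete group by counting: by
  von Dyck's theorem \<open>G\<^sub>4\<close> maps onto the concrete group of order \<open>p\<^sup>4\<close>, and \<open>|E/N| \<le> p\<^sup>4\<close>
  because \<open>N\<close> is non-trivial, so the map is an isomorphism and \<open>|N| = p\<close>.
\<close>

section \<open>Permutation representations and the minimal degree\<close>

text \<open>Actions given by plain functions, with no values prescribed outside \<open>A\<close>, are turned into the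
  extensional form of \<^locale>\<open>group_action\<close>, where the orbit-stabilizer theorem is available.\<close>

lemma group_actionI:
  fixes G (structure)
  assumes "group G"
    and closed: "\<And>g x. \<lbrakk>g \<in> carrier G; x \<in> A\<rbrakk> \<Longrightarrow> a g x \<in> A"
    and one: "\<And>x. x \<in> A \<Longrightarrow> a \<one> x = x"
    and mult: "\<And>g h x. \<lbrakk>g \<in> carrier G; h \<in> carrier G; x \<in> A\<rbrakk>
      \<Longrightarrow> a (g \<otimes> h) x = a g (a h x)"
  shows "group_action G A (\<lambda>g. restrict (a g) A)"
proof -
  interpret group G by fact
  have bij: "restrict (a g) A \<in> Bij A" if g: "g \<in> carrier G" for g
  proof -
    have "bij_betw (a g) A A"
    proof (rule bij_betw_byWitness[where f' = "a (inv g)"])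
      show "\<forall>x\<in>A. a (inv g) (a g x) = x" "\<forall>x\<in>A. a g (a (inv g) x) = x"
        using g one by (simp_all flip: mult)
    qed (use g closed in auto)
    then show ?thesis by (simp add: Bij_def)
  qed
  have "(\<lambda>g. restrict (a g) A) \<in> hom G (BijGroup A)"
  proof (rule homI)
    fix g h assume gh: "g \<in> carrier G" "h \<in> carrier G"
    show "restrict (a (g \<otimes> h)) A
        = restrict (a g) A \<otimes>\<^bsub>BijGroup A\<^esub> restrict (a h) A"
      using gh bij closed mult by (auto simp: BijGroup_def compose_def fun_eq_iff)
  qed (use bij in \<open>simp add: BijGroup_def\<close>)
  then show ?thesis
    by (simp add: group_action_def group_hom_def group_hom_axioms_def group_BijGroup is_group)
qed

text \<open>Numbering the points of \<open>A\<close> transports the action to \<open>{1..card A}\<close>. This is how embeddings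
  into symmetric groups are produced below: by left multiplication for Cayley's theorem, and by
  an explicit action for \<open>G\<^sub>4\<close>.\<close>

lemma faithful_action_imp_mon_sym_group:
  fixes G (structure)
  assumes "group G" "finite A"
    and closed: "\<And>g x. \<lbrakk>g \<in> carrier G; x \<in> A\<rbrakk> \<Longrightarrow> a g x \<in> A"
    and one: "\<And>x. x \<in> A \<Longrightarrow> a \<one> x = x"
    and mult: "\<And>g h x. \<lbrakk>g \<in> carrier G; h \<in> carrier G; x \<in> A\<rbrakk>
      \<Longrightarrow> a (g \<otimes> h) x = a g (a h x)"
    and faithful: "\<And>g. \<lbrakk>g \<in> carrier G; \<And>x. x \<in> A \<Longrightarrow> a g x = x\<rbrakk> \<Longrightarrow> g = \<one>"
  shows "\<exists>f. f \<in> mon G (sym_group (card A))"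
proof -
  interpret group G by fact
  obtain e where e: "bij_betw e A {1..card A}"
    using \<open>finite A\<close> ex_bij_betw_nat_finite_1 bij_betw_inv by blast
  define d where "d = inv_into A e"
  have d: "d i \<in> A" "e (d i) = i" if "i \<in> {1..card A}" for i
    using e that unfolding d_def bij_betw_def by (metis inv_into_into, metis f_inv_into_f)
  have ed: "d (e x) = x" "e x \<in> {1..card A}" if "x \<in> A" for x
    using e that unfolding d_def bij_betw_def by (auto simp: inv_into_f_f)
  define f where "f g i = (if i \<in> {1..card A} then e (a g (d i)) else i)" for g i
  have f_mult: "f (g \<otimes> h) = f g \<circ> f h" if "g \<in> carrier G" "h \<in> carrier G" for g h
    using that closed mult ed d by (auto simp: f_def fun_eq_iff simp del: atLeastAtMost_iff)
  have f_one: "f \<one> = id"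
    using one d by (auto simp: f_def fun_eq_iff simp del: atLeastAtMost_iff)
  have "f g permutes {1..card A}" if g: "g \<in> carrier G" for g
  proof -
    have "bij (f g)"
      using f_mult[of g "inv g"] f_mult[of "inv g" g] f_one g by (metis o_bij inv_closed l_inv r_inv)
    then show ?thesis by (auto simp: permutes_def f_def bij_iff)
  qed
  then have "f \<in> hom G (sym_group (card A))"
    using f_mult by (intro homI) (simp_all add: sym_group_def)
  moreover have "g = \<one>" if "g \<in> carrier G" "f g = id" for g
  proof (rule faithful)
    fix x assume x: "x \<in> A"
    have "e (a g x) = e x" using fun_cong[OF that(2), of "e x"] ed[OF x] by (simp add: f_def)
    then show "a g x = x" using e x closed that(1) by (metis bij_betw_imp_inj_on inj_onD)
  qed (rule that)
  ultimately show ?thesis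
    using mon_iff_hom_one[OF is_group sym_group_is_group] by (auto simp: sym_group_one)
qed

lemma minimal_degree_le: "f \<in> mon G (sym_group n) \<Longrightarrow> minimal_degree G \<le> n"
  unfolding minimal_degree_def by (rule Least_le) blast

text \<open>By Cayley's theorem the set of degrees is non-empty, so the \<open>LEAST\<close> in the definition of the
  minimal degree is a genuine minimum.\<close>

lemma minimal_degree_attained:
  assumes "group G" "finite (carrier G)"
  shows "\<exists>f. f \<in> mon G (sym_group (minimal_degree G))"
proof -
  interpret group G by fact
  have "\<exists>f. f \<in> mon G (sym_group (card (carrier G)))"
    by (rule faithful_action_imp_mon_sym_group[where a = "mult G"])
       (use assms in \<open>auto simp: m_assoc\<close>)
  then show ?thesis unfolding minimal_degree_def by (rule LeastI_ex[OF exI])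
qed

lemma mon_compose: "\<lbrakk>f \<in> mon G H; g \<in> mon H K\<rbrakk> \<Longrightarrow> g \<circ> f \<in> mon G K"
  by (auto simp: mon_def hom_compose intro!: comp_inj_on intro: inj_on_subset dest: hom_in_carrier)

section \<open>Commutators\<close>

context group
begin

lemma commutator_closed:
  "\<lbrakk>a \<in> carrier G; b \<in> carrier G\<rbrakk> \<Longrightarrow> commutator G a b \<in> carrier G"
  by (simp add: commutator_def)

lemma commutator_eq_one_iff:
  assumes "a \<in> carrier G" "b \<in> carrier G"
  shows "commutator G a b = \<one> \<longleftrightarrow> a \<otimes> b = b \<otimes> a"
proof -
  have "commutator G a b = inv (b \<otimes> a) \<otimes> (a \<otimes> b)"
    using assms by (simp add: commutator_def inv_mult_group m_assoc)
  then show ?thesis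
    using assms by (metis inv_closed inv_equality inv_inv l_inv m_closed)
qed

lemma inv_cancel [simp]:
  assumes "x \<in> carrier G" "y \<in> carrier G"
  shows "x \<otimes> (inv x \<otimes> y) = y" "inv x \<otimes> (x \<otimes> y) = y"
  using assms by (simp_all flip: m_assoc)

text \<open>Together with the uniqueness statement below, this characterizes \<open>[a, b]\<close> as the solution of
  \<open>b a x = a b\<close>; commutators are then computed without handling inverses.\<close>

lemma mult_commutator:
  "\<lbrakk>a \<in> carrier G; b \<in> carrier G\<rbrakk> \<Longrightarrow> b \<otimes> a \<otimes> commutator G a b = a \<otimes> b"
  by (simp add: commutator_def m_assoc)

lemma commutator_eqI:
  "\<lbrakk>b \<otimes> a \<otimes> x = a \<otimes> b; a \<in> carrier G; b \<in> carrier G; x \<in> carrier G\<rbrakk>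
    \<Longrightarrow> commutator G a b = x"
  using mult_commutator[of a b] by (metis commutator_closed inv_cancel(2) m_closed)

lemma conj_mult:
  "\<lbrakk>g \<in> carrier G; a \<in> carrier G; b \<in> carrier G\<rbrakk>
    \<Longrightarrow> inv g \<otimes> (a \<otimes> b) \<otimes> g = (inv g \<otimes> a \<otimes> g) \<otimes> (inv g \<otimes> b \<otimes> g)"
  by (simp add: m_assoc)

lemma commutator_conj:
  assumes "g \<in> carrier G" "a \<in> carrier G" "b \<in> carrier G"
  shows "commutator G (inv g \<otimes> a \<otimes> g) (inv g \<otimes> b \<otimes> g) = inv g \<otimes> commutator G a b \<otimes> g"
  using assms mult_commutator[of a b]
  by (intro commutator_eqI) (simp_all add: commutator_closed flip: conj_mult)

lemma commutator_central_mult: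
  assumes N: "central_subgroup G N"
    and z: "z \<in> N" "z' \<in> N" and h: "h \<in> carrier G" "h' \<in> carrier G"
  shows "commutator G (z \<otimes> h) (z' \<otimes> h') = commutator G h h'"
proof (rule commutator_eqI)
  have zc: "z \<in> carrier G" "z' \<in> carrier G"
    using N z subgroup.subset by (auto simp: central_subgroup_def)
  show "z \<otimes> h \<in> carrier G" "z' \<otimes> h' \<in> carrier G" "commutator G h h' \<in> carrier G"
    using zc h by (simp_all add: commutator_closed)
  have comm: "x \<otimes> w = w \<otimes> x" if "w \<in> N" "x \<in> carrier G" for w x
    using N that by (metis central_subgroup_def)
  have swap: "x \<otimes> k \<otimes> (y \<otimes> l) = x \<otimes> y \<otimes> (k \<otimes> l)"
    if "x \<in> carrier G" "y \<in> N" "y \<in> carrier G" "k \<in> carrier G" "l \<in> carrier G" for x y k l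
    using that comm[of y k] by (metis m_assoc m_closed)
  have "z' \<otimes> h' \<otimes> (z \<otimes> h) \<otimes> commutator G h h' = z' \<otimes> z \<otimes> (h' \<otimes> h \<otimes> commutator G h h')"
    using zc z h swap by (simp add: commutator_closed m_assoc)
  also have "\<dots> = z \<otimes> z' \<otimes> (h \<otimes> h')" using zc z h comm by (simp add: mult_commutator)
  also have "\<dots> = z \<otimes> h \<otimes> (z' \<otimes> h')" using zc z h swap[of z z' h h'] by simp
  finally show "z' \<otimes> h' \<otimes> (z \<otimes> h) \<otimes> commutator G h h' = z \<otimes> h \<otimes> (z' \<otimes> h')" .
qed

end

lemma (in group_hom) hom_commutator:
  "\<lbrakk>a \<in> carrier G; b \<in> carrier G\<rbrakk> \<Longrightarrow> h (commutator G a b) = commutator H (h a) (h b)"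
  by (simp add: commutator_def)

section \<open>Subgroups of prime index in p-groups\<close>

lemma prime_power_dvd_small:
  assumes "Factorial_Ring.prime (p::nat)" "c dvd p ^ m" "c < p ^ k"
  shows "\<exists>j<k. c = p ^ j"
proof -
  obtain j where "c = p ^ j" using assms divides_primepow_nat by blast
  then show ?thesis using assms power_less_imp_less_exp prime_gt_1_nat by metis
qed

context group
begin

lemma centralizer_subgroup:
  assumes "k \<in> carrier G"
  shows "subgroup {g \<in> carrier G. g \<otimes> k = k \<otimes> g} G"
proof (rule subgroupI)
  fix g assume "g \<in> {g \<in> carrier G. g \<otimes> k = k \<otimes> g}"
  then have g: "g \<in> carrier G" "g \<otimes> k = k \<otimes> g" by auto
  then have "inv g \<otimes> k = inv g \<otimes> (k \<otimes> g) \<otimes> inv g" using assms by (simp add: m_assoc)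
  also have "\<dots> = inv g \<otimes> (g \<otimes> k) \<otimes> inv g" using g by simp
  also have "\<dots> = k \<otimes> inv g" using g(1) assms by (simp flip: m_assoc)
  finally show "inv g \<in> {g \<in> carrier G. g \<otimes> k = k \<otimes> g}" using g by simp
next
  fix g h assume "g \<in> {g \<in> carrier G. g \<otimes> k = k \<otimes> g}" "h \<in> {g \<in> carrier G. g \<otimes> k = k \<otimes> g}"
  then show "g \<otimes> h \<in> {g \<in> carrier G. g \<otimes> k = k \<otimes> g}" using assms by (simp add: m_assoc) (simp flip: m_assoc)
qed (use assms in auto)

lemma card_subgroup_dvd_order: "subgroup H G \<Longrightarrow> card H dvd order G"
  using lagrange[of H] by (metis dvd_triv_right)

text \<open>The centralizer of \<open>b \<noteq> 1\<close> has more than one element, so by Lagrange it is the whole group.\<close>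

lemma prime_order_commute:
  assumes "Factorial_Ring.prime (order G)" "a \<in> carrier G" "b \<in> carrier G"
  shows "a \<otimes> b = b \<otimes> a"
proof (cases "b = \<one>")
  case False
  let ?C = "{g \<in> carrier G. g \<otimes> b = b \<otimes> g}"
  have fin: "finite (carrier G)"
    using assms(1) by (metis card.infinite not_prime_0 order_def)
  have "card ?C dvd order G"
    by (rule card_subgroup_dvd_order[OF centralizer_subgroup[OF assms(3)]])
  moreover have "card ?C \<noteq> 1"
  proof
    assume "card ?C = 1"
    moreover have "card {\<one>, b} \<le> card ?C" using assms fin by (intro card_mono) auto
    ultimately show False using False by simp
  qed
  ultimately have "card ?C = card (carrier G)"
    using assms(1) unfolding order_def by (auto simp: prime_nat_iff)
  then have "?C = carrier G" using fin by (intro card_subset_eq) auto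
  then show ?thesis using assms by blast
qed (use assms in simp)

text \<open>\<open>S\<close> acts on its \<open>p\<close> right cosets by right multiplication and fixes the coset \<open>S\<close>. The other
  \<open>p - 1\<close> cosets split into orbits whose lengths are powers of \<open>p\<close> below \<open>p\<close>, so they are fixed as
  well; \<open>S g s = S g\<close> for all \<open>s \<in> S\<close> means that \<open>S\<close> is normal.\<close>

lemma index_prime_normal:
  assumes p: "Factorial_Ring.prime p" and ord: "order G = p ^ m"
    and S: "subgroup S G" and index: "order G = p * card S"
  shows "S \<lhd> G"
proof -
  interpret S: subgroup S G by fact
  interpret GS: group "G\<lparr>carrier := S\<rparr>" by (rule subgroup_imp_group[OF S])
  have p0: "0 < p" using p prime_gt_0_nat by blast
  have fin: "finite (carrier G)"
    using ord p0 by (intro card_ge_0_finite) (simp flip: order_def)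
  have card_rc: "card (rcosets S) = p"
    using lagrange[OF S] index p0 fin S.finite_imp_card_positive
    by (metis mult_cancel2 not_gr_zero)
  have fin_rc: "finite (rcosets S)" using card_rc p0 by (metis card.infinite less_irrefl)
  have S_rc: "S \<in> rcosets S" using rcosetsI[of S \<one>] S.subset by (simp add: coset_mult_one)
  let ?a = "\<lambda>s C. C #> inv s"
  let ?\<phi> = "\<lambda>s. restrict (?a s) (rcosets S)"
  have closed: "C #> g \<in> rcosets S" if "C \<in> rcosets S" "g \<in> carrier G" for C g
    using that S.subset by (auto simp: RCOSETS_def coset_mult_assoc)
  have sub: "C \<subseteq> carrier G" if "C \<in> rcosets S" for C
    using that S.rcosets_carrier is_group by blast
  have act: "group_action (G\<lparr>carrier := S\<rparr>) (rcosets S) ?\<phi>"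
  proof (rule group_actionI[where a = ?a])
    show "group (G\<lparr>carrier := S\<rparr>)" by (rule GS.is_group)
  qed (use closed sub in \<open>auto simp: coset_mult_one coset_mult_assoc inv_mult_group\<close>)
  have fixed: "C #> inv s = C" if C: "C \<in> rcosets S" and s: "s \<in> S" for C s
  proof (cases "C = S")
    case True then show ?thesis using s by (simp add: coset_join2 S)
  next
    case False
    let ?O = "orbit (G\<lparr>carrier := S\<rparr>) ?\<phi> C"
    have mem: "C \<in> ?O" using group_action.orbit_refl[OF act C] .
    \<comment> \<open>the orbit of \<open>C\<close> avoids the fixed point \<open>S\<close>, so it has at most \<open>p - 1\<close> elements\<close>
    have "?O \<subseteq> rcosets S - {S}"
    proof
      fix D assume "D \<in> ?O"
      then obtain t where t: "t \<in> S" "D = C #> inv t" using C by (auto simp: orbit_def)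
      have "D \<noteq> S"
      proof
        assume "D = S"
        then have "C #> inv t #> t = S #> t" using t by simp
        then show False
          using False t sub[OF C] by (simp add: coset_mult_assoc coset_join2 S)
      qed
      then show "D \<in> rcosets S - {S}" using closed C t by simp
    qed
    then have "card ?O \<le> card (rcosets S - {S})" using fin_rc by (intro card_mono) auto
    also have "\<dots> < p" using S_rc fin_rc card_rc by (simp add: p0)
    finally have lt: "card ?O < p ^ 1" by simp
    have "card ?O dvd order (G\<lparr>carrier := S\<rparr>)"
      using group_action.orbit_stabilizer_theorem[OF act C] by (metis dvd_triv_left)
    moreover have "card S dvd p ^ m" using index ord by (metis dvd_triv_right)
    ultimately have "card ?O dvd p ^ m" by (simp add: order_def dvd_trans)
    from prime_power_dvd_small[OF p this lt] have "card ?O = 1" by auto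
    then have "?O = {C}" using mem by (metis card_1_singletonE singletonD)
    moreover have "C #> inv s \<in> ?O" using C s by (auto simp: orbit_def)
    ultimately show ?thesis by simp
  qed
  show ?thesis unfolding normal_inv_iff
  proof (intro conjI ballI)
    fix g s assume g: "g \<in> carrier G" and s: "s \<in> S"
    have sg: "s \<in> carrier G" using s by simp
    have "S #> g #> inv (inv s) = S #> g"
      using fixed[of "S #> g" "inv s"] g s S.subset by (simp add: rcosetsI)
    then have eq: "S #> (g \<otimes> s) = S #> g" using g sg S.subset by (simp add: coset_mult_assoc)
    have "S #> (g \<otimes> s \<otimes> inv g) = S #> (g \<otimes> s) #> inv g"
      using g sg S.subset by (simp add: coset_mult_assoc)
    also have "\<dots> = S" using eq g S.subset by (simp add: coset_mult_assoc)
    finally have "S #> (g \<otimes> s \<otimes> inv g) = S" .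
    then show "g \<otimes> s \<otimes> inv g \<in> S"
      using coset_join1[OF _ _ S] g sg by (metis inv_closed m_closed)
  qed (rule S)
qed

text \<open>The quotient by \<open>S\<close> has prime order, hence is abelian.\<close>

lemma commutator_in_index_prime:
  assumes p: "Factorial_Ring.prime p" and ord: "order G = p ^ m"
    and S: "subgroup S G" and index: "order G = p * card S"
    and ab: "a \<in> carrier G" "b \<in> carrier G"
  shows "commutator G a b \<in> S"
proof -
  interpret N: normal S G using index_prime_normal[OF assms(1-4)] .
  interpret Q: group "G Mod S" by (rule N.factorgroup_is_group)
  have p0: "0 < p" using p prime_gt_0_nat by blast
  have "finite (carrier G)"
    using ord p0 by (intro card_ge_0_finite) (simp flip: order_def)
  then have "order (G Mod S) = p"
    using lagrange[OF S] index N.finite_imp_card_positive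
    by (metis FactGroup_def mult_cancel2 not_gr_zero order_def partial_object.select_convs(1) p0)
  \<comment> \<open>\<open>[a, b] = a\<^sup>-\<^sup>1 b\<^sup>-\<^sup>1 (b\<^sup>-\<^sup>1 a\<^sup>-\<^sup>1)\<^sup>-\<^sup>1\<close>, so the cosets of the inverses are compared\<close>
  then have "(S #> inv a) \<otimes>\<^bsub>G Mod S\<^esub> (S #> inv b) = (S #> inv b) \<otimes>\<^bsub>G Mod S\<^esub> (S #> inv a)"
    using p ab N.subset by (intro Q.prime_order_commute) (auto simp: FactGroup_def rcosetsI)
  then have "S #> (inv a \<otimes> inv b) = S #> (inv b \<otimes> inv a)" using ab by (simp add: N.rcos_sum)
  then have "inv a \<otimes> inv b \<in> S #> (inv b \<otimes> inv a)"
    using ab repr_independenceD[OF S] by (metis inv_closed m_closed)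
  then have "inv a \<otimes> inv b \<otimes> inv (inv b \<otimes> inv a) \<in> S"
    using ab N.rcos_module_imp[OF is_group] by simp
  then show ?thesis using ab by (simp add: commutator_def inv_mult_group m_assoc)
qed

end

section \<open>Representations of degree less than p squared plus p\<close>

context group
begin

text \<open>The first alternative is the case of orbits of length at most \<open>p\<close>: an element in all subgroups of
  index \<open>p\<close> lies in all point stabilizers. The second is the case of an orbit of length \<open>p\<^sup>2\<close>, with
  \<open>H\<close> a point stabilizer on it: the remaining points are fixed, so an element all of whose conjugates
  lie in \<open>H\<close> acts trivially. The last condition says that \<open>H\<close> contains no non-trivial normal
  subgroup.\<close>

lemma small_degree_dichotomy:
  assumes p: "Factorial_Ring.prime p" and ord: "order G = p ^ m"
    and f: "f \<in> mon G (sym_group n)" and n: "n < p ^ 2 + p"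
  shows "(\<forall>x\<in>carrier G. (\<forall>S. subgroup S G \<and> order G = p * card S \<longrightarrow> x \<in> S) \<longrightarrow> x = \<one>)
    \<or> (\<exists>H. subgroup H G \<and> order G = p ^ 2 * card H
          \<and> (\<forall>k\<in>carrier G. (\<forall>g\<in>carrier G. inv g \<otimes> k \<otimes> g \<in> H) \<longrightarrow> k = \<one>))"
proof -
  let ?A = "{1..n}"
  let ?\<phi> = "\<lambda>g. restrict (f g) ?A"
  let ?O = "orbit G ?\<phi>" and ?S = "stabilizer G ?\<phi>"
  have p2: "2 \<le> p" using p by (rule prime_ge_2_nat)
  have hom: "f \<in> hom G (sym_group n)" using f by (simp add: mon_def)
  have perm: "f g permutes ?A" if "g \<in> carrier G" for g
    using hom_in_carrier[OF hom that] by (simp add: sym_group_def)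
  have f_mult: "f (g \<otimes> h) = f g \<circ> f h" if "g \<in> carrier G" "h \<in> carrier G" for g h
    using hom_mult[OF hom that] by (simp add: sym_group_def)
  have f_one: "f \<one> = id"
    using hom_one[OF hom is_group sym_group_is_group] by (simp add: sym_group_def)
  \<comment> \<open>\<open>f k\<close> is the identity outside \<open>{1..n}\<close> anyway, so faithfulness applies\<close>
  have trivial: "k = \<one>" if k: "k \<in> carrier G" and id_A: "\<And>i. i \<in> ?A \<Longrightarrow> f k i = i" for k
  proof -
    have "f k = id" using id_A perm[OF k] unfolding permutes_def by (auto simp: fun_eq_iff)
    then show ?thesis using f k mon_iff_hom_one[OF is_group sym_group_is_group]
      by (auto simp: sym_group_one)
  qed
  have act: "group_action G ?A ?\<phi>"
    by (rule group_actionI[where a = f])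
       (use perm f_mult f_one is_group in \<open>auto simp: permutes_in_image simp del: atLeastAtMost_iff\<close>)
  have orbit_mult: "card (?O i) * card (?S i) = order G" if "i \<in> ?A" for i
    by (rule group_action.orbit_stabilizer_theorem[OF act that])
  have orbit_sub: "?O i \<subseteq> ?A" if "i \<in> ?A" for i
    using that perm by (auto simp: orbit_def permutes_in_image simp del: atLeastAtMost_iff)
  have fixed: "f g i = i" if "card (?O i) = 1" "i \<in> ?A" "g \<in> carrier G" for g i
  proof -
    have "i \<in> ?O i" using group_action.orbit_refl[OF act that(2)] .
    moreover have "f g i \<in> ?O i" using that(2,3) by (auto simp: orbit_def)
    ultimately show ?thesis using that(1) by (metis card_1_singletonE singletonD)
  qed
  have small: "\<exists>j<k. card (?O i) = p ^ j" if "i \<in> ?A" "card (?O i) < p ^ k" for i k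
    using prime_power_dvd_small[OF p _ that(2)] orbit_mult[OF that(1)] ord by (metis dvd_triv_left)
  have stab: "?S i = {g \<in> carrier G. f g i = i}" if "i \<in> ?A" for i
    using that by (auto simp: stabilizer_def)
  have stab_sub: "subgroup (?S i) G" if "i \<in> ?A" for i
    by (rule group_action.stabilizer_subgroup[OF act that])
  show ?thesis
  proof (cases "\<exists>i\<in>?A. card (?O i) \<ge> p ^ 2")
    case True
    then obtain i where i: "i \<in> ?A" "p ^ 2 \<le> card (?O i)" by blast
    have "card (?O i) \<le> card ?A" using orbit_sub[OF i(1)] by (intro card_mono) auto
    also have "\<dots> < p ^ 3"
    proof -
      have "p ^ 2 + p \<le> p ^ 2 + p ^ 2" by (simp add: power2_eq_square)
      also have "\<dots> = 2 * p ^ 2" by simp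
      also have "\<dots> \<le> p * p ^ 2" using p2 by (intro mult_right_mono) auto
      finally show ?thesis using n by (simp add: power2_eq_square power3_eq_cube)
    qed
    finally obtain j where j: "j < 3" "card (?O i) = p ^ j" using small i(1) by blast
    have "2 \<le> j" using i(2) j(2) p2 by (metis power_le_imp_le_exp less_le_trans one_less_numeral_iff semiring_norm(76))
    then have "j = 2" using j(1) by simp
    then have card_O: "card (?O i) = p ^ 2" using j(2) by simp
    have "k = \<one>" if k: "k \<in> carrier G" and conj: "\<And>g. g \<in> carrier G \<Longrightarrow> inv g \<otimes> k \<otimes> g \<in> ?S i" for k
    proof (rule trivial[OF k])
      fix l assume l: "l \<in> ?A"
      show "f k l = l"
      proof (cases "l \<in> ?O i")
        case True
        then obtain g where g: "g \<in> carrier G" "l = f g i" using i(1) by (auto simp: orbit_def)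
        have "f (g \<otimes> (inv g \<otimes> k \<otimes> g)) i = f g (f (inv g \<otimes> k \<otimes> g) i)"
          using g k f_mult by simp
        also have "\<dots> = f g i" using conj[OF g(1)] stab[OF i(1)] by simp
        also have "g \<otimes> (inv g \<otimes> k \<otimes> g) = k \<otimes> g" using g k by (simp flip: m_assoc)
        finally show ?thesis using g k f_mult by simp
      next
        case False
        have "?O l \<inter> ?O i = {}"
          using group_action.disjoint_union[OF act, of "?O l" "?O i"] l i(1) False
            group_action.orbit_refl[OF act l] unfolding orbits_def by blast
        moreover have "finite (?O l)" "finite (?O i)"
          using orbit_sub[OF l] orbit_sub[OF i(1)] by (metis finite_atLeastAtMost finite_subset)+
        ultimately have "card (?O l) + card (?O i) = card (?O l \<union> ?O i)"
          by (simp only: card_Un_disjoint)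
        also have "\<dots> \<le> card ?A" using orbit_sub[OF l] orbit_sub[OF i(1)] by (intro card_mono) blast+
        finally have "card (?O l) + card (?O i) \<le> card ?A" .
        then have "card (?O l) < p ^ 1" using card_O n by simp
        from small[OF l this] have "card (?O l) = 1" by auto
        then show ?thesis by (rule fixed[OF _ l k])
      qed
    qed
    moreover have "order G = p ^ 2 * card (?S i)" using orbit_mult[OF i(1)] card_O by simp
    ultimately show ?thesis using stab_sub[OF i(1)] by blast
  next
    case False
    have "x = \<one>" if x: "x \<in> carrier G"
      and all: "\<And>S. subgroup S G \<Longrightarrow> order G = p * card S \<Longrightarrow> x \<in> S" for x
    proof (rule trivial[OF x])
      fix i assume i: "i \<in> ?A"
      have "card (?O i) < p ^ 2" using False i by (meson not_le)
      then obtain j where j: "j < 2" "card (?O i) = p ^ j" using small[OF i] by blast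
      show "f x i = i"
      proof (cases "j = 0")
        case True then show ?thesis using fixed[OF _ i x] j by simp
      next
        case False
        then have "j = 1" using j(1) by simp
        then have "x \<in> ?S i" using all[OF stab_sub[OF i]] orbit_mult[OF i] j(2) by simp
        then show ?thesis using stab[OF i] by simp
      qed
    qed
    then show ?thesis by blast
  qed
qed

text \<open>The map \<open>h \<mapsto> [h, t]\<close> is injective on \<open>H\<close> for every \<open>t\<close> outside \<open>N H\<close>, and \<open>H\<close> has \<open>p\<^sup>3\<close>
  elements.\<close>

lemma core_free_imp_many_commutators:
  assumes p: "Factorial_Ring.prime p" and ord: "order G = p ^ 5"
    and N: "central_subgroup G N" and card_N: "card N = p"
    and H: "subgroup H G" and index: "order G = p ^ 2 * card H"
    and core: "\<And>k. \<lbrakk>k \<in> carrier G; \<And>g. g \<in> carrier G \<Longrightarrow> inv g \<otimes> k \<otimes> g \<in> H\<rbrakk> \<Longrightarrow> k = \<one>"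
  shows "p ^ 2 < card {commutator G a b | a b. a \<in> carrier G \<and> b \<in> carrier G}"
proof -
  interpret H: subgroup H G by fact
  have N_sub: "subgroup N G" and N_comm: "\<And>z g. \<lbrakk>z \<in> N; g \<in> carrier G\<rbrakk> \<Longrightarrow> z \<otimes> g = g \<otimes> z"
    using N by (auto simp: central_subgroup_def)
  interpret N: subgroup N G by (rule N_sub)
  have p1: "1 < p" using p by (rule prime_gt_1_nat)
  have fin: "finite (carrier G)"
    using ord p1 by (intro card_ge_0_finite) (simp flip: order_def)
  have "p ^ 2 * card H = p ^ 2 * p ^ 3" using ord index by (simp flip: power_add)
  then have card_H: "card H = p ^ 3" using p1 by (metis mult_cancel1 not_one_less_zero power_not_zero)
  \<comment> \<open>applied to \<open>N \<inter> H\<close> to count \<open>N H\<close>, and at the end to an element that commutes with \<open>t\<close>\<close>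
  have central_H: "k = \<one>" if k: "k \<in> H" and c: "\<And>g. g \<in> carrier G \<Longrightarrow> g \<otimes> k = k \<otimes> g" for k
  proof (rule core)
    fix g assume g: "g \<in> carrier G"
    have "inv g \<otimes> k \<otimes> g = k" using c[of "inv g"] g k by (simp add: m_assoc)
    then show "inv g \<otimes> k \<otimes> g \<in> H" using k by simp
  qed (use k in simp)
  have N_normal: "N \<lhd> G"
    unfolding normal_inv_iff
  proof (intro conjI ballI N_sub)
    fix g z assume "g \<in> carrier G" "z \<in> N"
    then have "g \<otimes> z \<otimes> inv g = z"
      using N_comm[of z g, symmetric] by (simp add: m_assoc)
    then show "g \<otimes> z \<otimes> inv g \<in> N" using \<open>z \<in> N\<close> by simp
  qed
  let ?M = "N <#> H"
  have M: "subgroup ?M G" by (rule mult_norm_subgroup[OF N_normal H])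
  have card_M: "card ?M = p ^ 4"
  proof -
    have "inj_on (\<lambda>(z, h). z \<otimes> h) (N \<times> H)"
    proof (rule inj_onI, clarify)
      fix z h z' h' assume zh: "z \<in> N" "h \<in> H" "z' \<in> N" "h' \<in> H" and eq: "z \<otimes> h = z' \<otimes> h'"
      have "inv z' \<otimes> z = inv z' \<otimes> (z \<otimes> h) \<otimes> inv h" using zh by (simp add: m_assoc)
      also have "\<dots> = h' \<otimes> inv h" unfolding eq using zh by (simp flip: m_assoc)
      finally have e: "inv z' \<otimes> z = h' \<otimes> inv h" .
      have "inv z' \<otimes> z \<in> N" using zh by simp
      moreover have "inv z' \<otimes> z \<in> H" unfolding e using zh by simp
      ultimately have "inv z' \<otimes> z = \<one>" using N_comm by (intro central_H) auto
      then have "z = z'" using zh by (metis N.mem_carrier inv_closed inv_equality inv_inv)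
      then show "z = z' \<and> h = h'" using eq zh by simp
    qed
    moreover have "?M = (\<lambda>(z, h). z \<otimes> h) ` (N \<times> H)" by (auto simp: set_mult_def)
    ultimately have "card ?M = card N * card H" by (simp add: card_image card_cartesian_product)
    then show ?thesis using card_N card_H by (simp add: numeral_eq_Suc)
  qed
  have "order G = p * card ?M" using ord card_M by (simp add: numeral_eq_Suc)
  then have M_normal: "?M \<lhd> G" by (rule index_prime_normal[OF p ord M])
  \<comment> \<open>conjugates of elements of \<open>H\<close> lie in the normal subgroup \<open>N H\<close>, and the factor from \<open>N\<close>
      disappears in commutators; so every conjugate of \<open>[h, h']\<close> is in \<open>H\<close>\<close>
  have H_abelian: "h \<otimes> h' = h' \<otimes> h" if h: "h \<in> H" "h' \<in> H" for h h'
  proof -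
    have "commutator G h h' = \<one>"
    proof (rule core)
      fix g assume g: "g \<in> carrier G"
      have conj: "inv g \<otimes> a \<otimes> g \<in> ?M" if "a \<in> H" for a
      proof -
        have "\<one> \<otimes> a \<in> ?M" unfolding set_mult_def using that N.one_closed by blast
        then show ?thesis using normal.inv_op_closed1[OF M_normal g] that by simp
      qed
      obtain z k where zk: "z \<in> N" "k \<in> H" "inv g \<otimes> h \<otimes> g = z \<otimes> k"
        using conj[OF h(1)] by (auto simp: set_mult_def)
      obtain z' k' where zk': "z' \<in> N" "k' \<in> H" "inv g \<otimes> h' \<otimes> g = z' \<otimes> k'"
        using conj[OF h(2)] by (auto simp: set_mult_def)
      have "inv g \<otimes> commutator G h h' \<otimes> g = commutator G k k'"
        using commutator_conj[OF g, of h h'] commutator_central_mult[OF N] h zk zk' by simp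
      then show "inv g \<otimes> commutator G h h' \<otimes> g \<in> H"
        using zk zk' by (simp add: commutator_def)
    qed (use h in \<open>simp add: commutator_closed\<close>)
    then show ?thesis using h commutator_eq_one_iff by simp
  qed
  have "?M \<noteq> carrier G" using card_M ord p1 by (auto simp: order_def numeral_eq_Suc)
  then obtain t where t: "t \<in> carrier G" "t \<notin> ?M" using M subgroup.subset by blast
  let ?X = "{commutator G a b | a b. a \<in> carrier G \<and> b \<in> carrier G}"
  have "inj_on (\<lambda>h. commutator G h t) H"
  proof (rule inj_onI)
    fix h h' assume h: "h \<in> H" "h' \<in> H" and eq: "commutator G h t = commutator G h' t"
    let ?k = "h' \<otimes> inv h"
    let ?C = "{g \<in> carrier G. g \<otimes> ?k = ?k \<otimes> g}"
    have k: "?k \<in> H" using h by simp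
    have C: "subgroup ?C G" using k by (intro centralizer_subgroup) simp
    have "?k \<otimes> inv t = h' \<otimes> commutator G h t \<otimes> inv t \<otimes> inv h"
      using h t by (simp add: commutator_def m_assoc)
    also have "\<dots> = inv t \<otimes> ?k"
      unfolding eq using h t by (simp add: commutator_def m_assoc)
    finally have "inv t \<in> ?C" using t by simp
    from subgroup.m_inv_closed[OF C this] have "t \<in> ?C" using t(1) by (simp only: inv_inv)
    moreover have "?M \<subseteq> ?C"
    proof
      fix y assume "y \<in> ?M"
      then obtain z l where y: "z \<in> N" "l \<in> H" "y = z \<otimes> l" by (auto simp: set_mult_def)
      have "z \<otimes> l \<otimes> ?k = z \<otimes> (?k \<otimes> l)" using y k H_abelian by (simp add: m_assoc)
      also have "\<dots> = (z \<otimes> ?k) \<otimes> l" using y k by (simp add: m_assoc del: inv_cancel)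
      also have "z \<otimes> ?k = ?k \<otimes> z" using N_comm[OF y(1)] k by simp
      also have "?k \<otimes> z \<otimes> l = ?k \<otimes> (z \<otimes> l)" using y k by (intro m_assoc) simp_all
      finally show "y \<in> ?C" using y by simp
    qed
    \<comment> \<open>the centralizer of \<open>?k\<close> is strictly larger than a subgroup of index \<open>p\<close>, so it is everything\<close>
    ultimately have "?M \<subset> ?C" using t by blast
    then have "card ?M < card ?C" using fin by (intro psubset_card_mono) auto
    then have gt: "p ^ 4 < card ?C" by (simp only: card_M)
    have "card ?C dvd p ^ 5" using card_subgroup_dvd_order[OF C] ord by simp
    then obtain j where j: "j \<le> 5" "card ?C = p ^ j"
      using divides_primepow_nat[OF p] by blast
    have "4 < j" using gt p1 unfolding j(2) by (rule power_less_imp_less_exp[rotated])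
    then have "j = 5" using j(1) by simp
    then have "card ?C = p ^ 5" using j(2) by simp
    then have "?C = carrier G" using fin ord by (intro card_subset_eq) (auto simp: order_def)
    then have "?k = \<one>" using k by (intro central_H) auto
    then show "h = h'" using h by (metis H.mem_carrier inv_closed inv_equality inv_inv)
  qed
  then have "card H \<le> card ?X"
  proof (rule card_inj_on_le)
    have "?X \<subseteq> carrier G" by (auto simp: commutator_closed)
    then show "finite ?X" using fin by (rule finite_subset)
    show "(\<lambda>h. commutator G h t) ` H \<subseteq> ?X" using t(1) H.subset by blast
  qed
  moreover have "p ^ 2 < p ^ 3" using p1 by simp
  ultimately show ?thesis using card_H by simp
qed

end

section \<open>Homomorphisms out of a presented group\<close>

fun letter_value :: "('a, 'b) monoid_scheme \<Rightarrow> ('g \<Rightarrow> 'a) \<Rightarrow> 'g \<times> bool \<Rightarrow> 'a" where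
  "letter_value K \<phi> (g, b) = (if b then \<phi> g else inv\<^bsub>K\<^esub> \<phi> g)"

definition word_value :: "('a, 'b) monoid_scheme \<Rightarrow> ('g \<Rightarrow> 'a) \<Rightarrow> 'g word \<Rightarrow> 'a" where
  "word_value K \<phi> u = foldr (\<lambda>l a. letter_value K \<phi> l \<otimes>\<^bsub>K\<^esub> a) u \<one>\<^bsub>K\<^esub>"

text \<open>A word is evaluated in \<open>K\<close> letter by letter. Deleting a cancelling pair does not change the value,
  so it is constant on the classes of words.\<close>

lemma free_group_universal:
  fixes K (structure)
  assumes "group K" and \<phi>: "\<And>g. \<phi> g \<in> carrier K"
  shows "\<exists>\<Phi> \<in> hom free_group K. \<forall>g. \<Phi> (free_gen g) = \<phi> g"
proof -
  interpret group K by fact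
  let ?l = "letter_value K \<phi>" and ?v = "word_value K \<phi>"
  have l_closed: "?l l \<in> carrier K" for l using \<phi> by (cases l) simp
  have v_simps: "?v [] = \<one>" "?v (l # u) = ?l l \<otimes> ?v u" for l u
    by (simp_all add: word_value_def)
  have v_closed: "?v u \<in> carrier K" for u
    by (induction u) (simp_all add: v_simps l_closed)
  have v_append: "?v (u @ w) = ?v u \<otimes> ?v w" for u w
    by (induction u) (simp_all add: v_simps l_closed v_closed m_assoc)
  have v_cong: "?v u = ?v w" if "word_eq u w" for u w
    using that
  proof (induction rule: word_eq.induct)
    case (cancel u g b w)
    have "?l (g, b) \<otimes> (?l (g, \<not> b) \<otimes> ?v w) = ?v w"
      using \<phi>[of g] v_closed[of w] by (simp flip: m_assoc)
    then show ?case by (simp add: v_append v_simps del: letter_value.simps)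
  qed auto
  define \<Phi> where "\<Phi> A = ?v (SOME u. u \<in> A)" for A
  have \<Phi>_class: "\<Phi> (word_rel `` {u}) = ?v u" for u
  proof -
    have "(SOME w. w \<in> word_rel `` {u}) \<in> word_rel `` {u}"
      by (rule someI[of _ u]) (simp add: word_rel_def word_eq.refl)
    then show ?thesis unfolding \<Phi>_def by (simp add: word_rel_def v_cong)
  qed
  have "\<Phi> \<in> hom free_group K"
    by (rule homI)
       (auto elim!: free_group_carrierE simp: free_group_mult_class \<Phi>_class v_closed v_append)
  moreover have "\<Phi> (free_gen g) = \<phi> g" for g
    using \<phi>[of g] by (simp add: free_gen_def \<Phi>_class v_simps)
  ultimately show ?thesis by blast
qed

lemma hom_normal_closure:
  assumes "group G" "group K" and \<Phi>: "\<Phi> \<in> hom G K"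
    and S: "S \<subseteq> carrier G" "\<And>s. s \<in> S \<Longrightarrow> \<Phi> s = \<one>\<^bsub>K\<^esub>"
  shows "normal_closure G S \<subseteq> kernel G K \<Phi>" 
proof -
  interpret group_hom G K \<Phi> using assms by (simp add: group_hom_def group_hom_axioms_def)
  have "kernel G K \<Phi> \<lhd> G" by (rule normal_kernel)
  moreover have "S \<subseteq> kernel G K \<Phi>" using S by (auto simp: kernel_def)
  ultimately show ?thesis unfolding normal_closure_def by blast
qed

text \<open>The kernel of \<open>\<Phi>\<close> is a normal subgroup that contains all relators, hence their normal closure, and
  so \<open>\<Phi>\<close> factors through the quotient. The inclusion of images records that the induced map is onto
  whenever \<open>\<Phi>\<close> is.\<close>

lemma von_Dyck:
  fixes K (structure)
  assumes "group K" and \<Phi>: "\<Phi> \<in> hom free_group K"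
    and R: "\<And>u v. (u, v) \<in> R \<Longrightarrow> u \<in> carrier free_group \<and> v \<in> carrier free_group \<and> \<Phi> u = \<Phi> v"
  shows "\<exists>\<Psi> \<in> hom (presented_group R) K.
    \<Phi> ` carrier free_group \<subseteq> \<Psi> ` carrier (presented_group R)"
proof -
  interpret group K by fact
  let ?F = "free_group :: 'c word set monoid"
  interpret F: group ?F by (rule group_free_group)
  interpret \<Phi>: group_hom ?F K \<Phi>
    using \<Phi> by (simp add: group_hom_def group_hom_axioms_def is_group F.is_group)
  let ?S = "{u \<otimes>\<^bsub>?F\<^esub> inv\<^bsub>?F\<^esub> v | u v. (u, v) \<in> R}"
  let ?N = "normal_closure ?F ?S"
  have rel: "\<Phi> s = \<one>" if "s \<in> ?S" for s
  proof -
    obtain u v where "s = u \<otimes>\<^bsub>?F\<^esub> inv\<^bsub>?F\<^esub> v" "(u, v) \<in> R" using \<open>s \<in> ?S\<close> by blast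
    then show ?thesis using R[of u v] by simp
  qed
  have ker: "?N \<subseteq> kernel ?F K \<Phi>"
    using R rel by (intro hom_normal_closure[OF F.is_group is_group \<Phi>]) auto
  have one: "\<one>\<^bsub>?F\<^esub> \<in> ?N"
    using subgroup.one_closed[OF normal_imp_subgroup] by (auto simp: normal_closure_def)
  have P: "presented_group R = ?F Mod ?N" by (simp add: presented_group_def)
  have image: "\<Phi> ` (?N #>\<^bsub>?F\<^esub> g) = {\<Phi> g}" if "g \<in> carrier ?F" for g
  proof -
    have "\<Phi> (n \<otimes>\<^bsub>?F\<^esub> g) = \<Phi> g" if "n \<in> ?N" for n
      using ker that \<open>g \<in> carrier ?F\<close> by (auto simp: kernel_def)
    then have "(\<lambda>n. \<Phi> (n \<otimes>\<^bsub>?F\<^esub> g)) ` ?N = (\<lambda>n. \<Phi> g) ` ?N" by (intro image_cong HOL.refl)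
    moreover have "?N #>\<^bsub>?F\<^esub> g = (\<lambda>n. n \<otimes>\<^bsub>?F\<^esub> g) ` ?N" by (auto simp: r_coset_def)
    ultimately show ?thesis using one by (auto simp: image_image)
  qed
  have sub: "?N #>\<^bsub>?F\<^esub> g \<subseteq> carrier ?F" if "g \<in> carrier ?F" for g
    using ker that by (auto simp: kernel_def r_coset_def)
  let ?\<Psi> = "\<lambda>A. the_elem (\<Phi> ` A)"
  have "?\<Psi> \<in> hom (presented_group R) K"
    unfolding P
  proof (rule homI)
    fix A assume "A \<in> carrier (?F Mod ?N)"
    then show "?\<Psi> A \<in> carrier K" using image by (auto simp: FactGroup_def RCOSETS_def)
  next
    fix A B assume "A \<in> carrier (?F Mod ?N)" "B \<in> carrier (?F Mod ?N)"
    then obtain g h where g: "g \<in> carrier ?F" "A = ?N #>\<^bsub>?F\<^esub> g" and h: "h \<in> carrier ?F" "B = ?N #>\<^bsub>?F\<^esub> h"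
      by (auto simp: FactGroup_def RCOSETS_def)
    have "\<Phi> ` (A <#>\<^bsub>?F\<^esub> B) = {\<Phi> a \<otimes> \<Phi> b | a b. a \<in> A \<and> b \<in> B}"
    proof -
      have "\<Phi> ` (A <#>\<^bsub>?F\<^esub> B) = {\<Phi> (a \<otimes>\<^bsub>?F\<^esub> b) | a b. a \<in> A \<and> b \<in> B}"
        by (auto simp: set_mult_def)
      also have "\<dots> = {\<Phi> a \<otimes> \<Phi> b | a b. a \<in> A \<and> b \<in> B}"
        using sub g h by (metis (no_types, lifting) \<Phi>.hom_mult subsetD)
      finally show ?thesis .
    qed
    also have "\<dots> = {x \<otimes> y | x y. x \<in> \<Phi> ` A \<and> y \<in> \<Phi> ` B}" by blast
    also have "\<dots> = {\<Phi> g \<otimes> \<Phi> h}" unfolding g(2) h(2) image[OF g(1)] image[OF h(1)] by blast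
    finally show "?\<Psi> (A \<otimes>\<^bsub>?F Mod ?N\<^esub> B) = ?\<Psi> A \<otimes> ?\<Psi> B"
      using g h image by simp
  qed
  moreover have "\<Phi> ` carrier ?F \<subseteq> ?\<Psi> ` carrier (presented_group R)"
  proof
    fix y assume "y \<in> \<Phi> ` carrier ?F"
    then obtain g where g: "g \<in> carrier ?F" "y = \<Phi> g" by blast
    then have "y = ?\<Psi> (?N #>\<^bsub>?F\<^esub> g)" using image by simp
    moreover have "?N #>\<^bsub>?F\<^esub> g \<in> carrier (presented_group R)"
      using g unfolding P by (auto simp: FactGroup_def RCOSETS_def)
    ultimately show "y \<in> ?\<Psi> ` carrier (presented_group R)" by blast
  qed
  ultimately show ?thesis by blast
qed

section \<open>The Heisenberg group times a cyclic group\<close>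

text \<open>The first three coordinates form the Heisenberg group of upper unitriangular \<open>3 \<times> 3\<close> matrices over
  the integers modulo \<open>q\<close>, with \<open>c\<close> the corner entry; the last one is the cyclic factor.\<close>

definition heis_cyclic :: "int \<Rightarrow> (int \<times> int \<times> int \<times> int) monoid" where
  "heis_cyclic q = \<lparr>carrier = {0..<q} \<times> {0..<q} \<times> {0..<q} \<times> {0..<q},
     monoid.mult = (\<lambda>(a, b, c, d) (a', b', c', d').
       ((a + a') mod q, (b + b') mod q, (c + c' + a * b') mod q, (d + d') mod q)),
     one = (0, 0, 0, 0)\<rparr>"

lemma heis_cyclic_mult:
  "(a, b, c, d) \<otimes>\<^bsub>heis_cyclic q\<^esub> (a', b', c', d')
    = ((a + a') mod q, (b + b') mod q, (c + c' + a * b') mod q, (d + d') mod q)"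
  by (simp add: heis_cyclic_def)

lemma heis_cyclic_one: "\<one>\<^bsub>heis_cyclic q\<^esub> = (0, 0, 0, 0)"
  by (simp add: heis_cyclic_def)

lemma heis_cyclic_carrier:
  "(a, b, c, d) \<in> carrier (heis_cyclic q) \<longleftrightarrow>
    a \<in> {0..<q} \<and> b \<in> {0..<q} \<and> c \<in> {0..<q} \<and> d \<in> {0..<q}"
  by (simp add: heis_cyclic_def)

lemma order_heis_cyclic: "order (heis_cyclic (int p)) = p ^ 4"
  by (simp add: order_def heis_cyclic_def card_cartesian_product numeral_eq_Suc)

lemma group_heis_cyclic:
  assumes "0 < q"
  shows "group (heis_cyclic q)"
proof (rule groupI)
  fix x assume "x \<in> carrier (heis_cyclic q)"
  then obtain a b c d where x: "x = (a, b, c, d)"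
    and "a \<in> {0..<q}" "b \<in> {0..<q}" "c \<in> {0..<q}" "d \<in> {0..<q}"
    by (cases x) (auto simp: heis_cyclic_carrier)
  let ?y = "(- a mod q, - b mod q, (a * b - c) mod q, - d mod q)"
  have "?y \<in> carrier (heis_cyclic q)" using assms by (simp add: heis_cyclic_carrier)
  moreover have "?y \<otimes>\<^bsub>heis_cyclic q\<^esub> x = \<one>\<^bsub>heis_cyclic q\<^esub>"
  proof -
    have "((a * b - c) mod q + c + - a mod q * b) mod q = ((a * b - c) + c + - a * b) mod q"
      by (intro mod_add_cong mod_mult_cong) simp_all
    then show ?thesis by (simp add: x heis_cyclic_mult heis_cyclic_one mod_simps)
  qed
  ultimately show "\<exists>y\<in>carrier (heis_cyclic q). y \<otimes>\<^bsub>heis_cyclic q\<^esub> x = \<one>\<^bsub>heis_cyclic q\<^esub>" by blast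
next
  fix x y z
  assume "x \<in> carrier (heis_cyclic q)" "y \<in> carrier (heis_cyclic q)" "z \<in> carrier (heis_cyclic q)"
  obtain a b c d a' b' c' d' a'' b'' c'' d''
    where xyz: "x = (a, b, c, d)" "y = (a', b', c', d')" "z = (a'', b'', c'', d'')"
    by (cases x; cases y; cases z)
  have "((c + c' + a * b') mod q + c'' + (a + a') mod q * b'') mod q
      = ((c + c' + a * b') + c'' + (a + a') * b'') mod q"
    by (intro mod_add_cong mod_mult_cong) simp_all
  also have "\<dots> = (c + (c' + c'' + a' * b'') + a * (b' + b'')) mod q"
    by (simp add: algebra_simps)
  also have "\<dots> = (c + (c' + c'' + a' * b'') mod q + a * ((b' + b'') mod q)) mod q"
    by (intro mod_add_cong mod_mult_cong) simp_all
  finally show "x \<otimes>\<^bsub>heis_cyclic q\<^esub> y \<otimes>\<^bsub>heis_cyclic q\<^esub> z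
      = x \<otimes>\<^bsub>heis_cyclic q\<^esub> (y \<otimes>\<^bsub>heis_cyclic q\<^esub> z)"
    by (simp add: xyz heis_cyclic_mult mod_simps add.assoc)
qed (use assms in \<open>auto simp: heis_cyclic_mult heis_cyclic_one heis_cyclic_carrier\<close>)


lemma heis_cyclic_pow:
  assumes "1 < q"
  shows "(1, 0, 0, 0) [^]\<^bsub>heis_cyclic q\<^esub> (n::nat) = (int n mod q, 0, 0, 0)"
    and "(0, 1, 0, 0) [^]\<^bsub>heis_cyclic q\<^esub> (n::nat) = (0, int n mod q, 0, 0)"
    and "(0, 0, 1, 0) [^]\<^bsub>heis_cyclic q\<^esub> (n::nat) = (0, 0, int n mod q, 0)"
    and "(0, 0, 0, 1) [^]\<^bsub>heis_cyclic q\<^esub> (n::nat) = (0, 0, 0, int n mod q)"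
  using assms by (induction n) (simp_all add: nat_pow_def heis_cyclic_one heis_cyclic_mult mod_simps algebra_simps)

text \<open>All commutators lie in the centre \<open>{(0, 0, c, 0)}\<close> of the Heisenberg factor, so there are at most
  \<open>q\<close> of them; the generators \<open>x\<close> and \<open>y\<close> give \<open>(0, 0, 1, 0)\<close>.\<close>

lemma heis_cyclic_commutator:
  assumes q: "0 < q"
    and x: "(a, b, c, d) \<in> carrier (heis_cyclic q)" and y: "(a', b', c', d') \<in> carrier (heis_cyclic q)"
  shows "commutator (heis_cyclic q) (a, b, c, d) (a', b', c', d') = (0, 0, (a * b' - a' * b) mod q, 0)"
proof -
  interpret group "heis_cyclic q" by (rule group_heis_cyclic[OF q])
  show ?thesis
  proof (rule commutator_eqI[OF _ x y])
    have "((c' + c + a' * b) mod q + (a * b' - a' * b) mod q + (a' + a) mod q * 0) mod q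
        = (c' + c + a' * b + (a * b' - a' * b) + (a' + a) * 0) mod q"
      by (intro mod_add_cong mod_mult_cong) simp_all
    then show "(a', b', c', d') \<otimes>\<^bsub>heis_cyclic q\<^esub> (a, b, c, d)
        \<otimes>\<^bsub>heis_cyclic q\<^esub> (0, 0, (a * b' - a' * b) mod q, 0)
      = (a, b, c, d) \<otimes>\<^bsub>heis_cyclic q\<^esub> (a', b', c', d')"
      by (simp add: heis_cyclic_mult mod_simps ac_simps)
  qed (use q in \<open>simp add: heis_cyclic_carrier\<close>)
qed

text \<open>A unitriangular matrix acts on the column \<open>(j, i, 1)\<close>, that is, on \<open>q\<^sup>2\<close> pairs; the cyclic factor acts
  on \<open>q\<close> further points by rotation.\<close>

fun heis_cyclic_action :: "int \<Rightarrow> int \<times> int \<times> int \<times> int \<Rightarrow> int \<times> int + int \<Rightarrow> int \<times> int + int" where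
  "heis_cyclic_action q (a, b, c, d) (Inl (i, j)) = Inl ((i + b) mod q, (j + c + a * i) mod q)"
| "heis_cyclic_action q (a, b, c, d) (Inr k) = Inr ((k + d) mod q)"

lemma heis_cyclic_mon_sym_group:
  assumes p: "1 < p"
  shows "\<exists>f. f \<in> mon (heis_cyclic (int p)) (sym_group (p ^ 2 + p))"
proof -
  let ?q = "int p"
  let ?A = "{0..<?q} \<times> {0..<?q} <+> {0..<?q}"
  have "\<exists>f. f \<in> mon (heis_cyclic ?q) (sym_group (card ?A))"
  proof (rule faithful_action_imp_mon_sym_group[where a = "heis_cyclic_action ?q"])
    show "group (heis_cyclic ?q)" using p by (intro group_heis_cyclic) simp
  next
    fix g x assume "g \<in> carrier (heis_cyclic ?q)" "x \<in> ?A"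
    then show "heis_cyclic_action ?q g x \<in> ?A"
      using p by (cases g) auto
  next
    fix x assume "x \<in> ?A"
    then show "heis_cyclic_action ?q \<one>\<^bsub>heis_cyclic ?q\<^esub> x = x"
      by (auto simp: heis_cyclic_one)
  next
    fix g h x assume "g \<in> carrier (heis_cyclic ?q)" "h \<in> carrier (heis_cyclic ?q)" "x \<in> ?A"
    obtain a b c d where g: "g = (a, b, c, d)" by (cases g)
    obtain a' b' c' d' where h: "h = (a', b', c', d')" by (cases h)
    have "(j + (c + c' + a * b') mod ?q + (a + a') mod ?q * i) mod ?q
        = ((j + c' + a' * i) mod ?q + c + a * ((i + b') mod ?q)) mod ?q" for i j
    proof -
      have "(j + (c + c' + a * b') mod ?q + (a + a') mod ?q * i) mod ?q
          = (j + (c + c' + a * b') + (a + a') * i) mod ?q"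
        by (intro mod_add_cong mod_mult_cong) simp_all
      also have "\<dots> = ((j + c' + a' * i) + c + a * (i + b')) mod ?q"
        by (simp add: algebra_simps)
      also have "\<dots> = ((j + c' + a' * i) mod ?q + c + a * ((i + b') mod ?q)) mod ?q"
        by (intro mod_add_cong mod_mult_cong) simp_all
      finally show ?thesis .
    qed
    then show "heis_cyclic_action ?q (g \<otimes>\<^bsub>heis_cyclic ?q\<^esub> h) x
        = heis_cyclic_action ?q g (heis_cyclic_action ?q h x)"
      using \<open>x \<in> ?A\<close> by (auto simp: g h heis_cyclic_mult mod_simps ac_simps)
  next
    fix g assume g: "g \<in> carrier (heis_cyclic ?q)"
      and triv: "\<And>x. x \<in> ?A \<Longrightarrow> heis_cyclic_action ?q g x = x"
    obtain a b c d where g_eq: "g = (a, b, c, d)" by (cases g)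
    have pts: "Inl (0, 0) \<in> ?A" "Inl (1, 0) \<in> ?A" "Inr 0 \<in> ?A" using p by auto
    show "g = \<one>\<^bsub>heis_cyclic ?q\<^esub>"
      using triv[OF pts(1)] triv[OF pts(2)] triv[OF pts(3)] g p
      by (auto simp: g_eq heis_cyclic_carrier heis_cyclic_one)
  qed simp
  moreover have "card ?A = p ^ 2 + p"
    by (simp add: card_Plus card_cartesian_product power2_eq_square)
  ultimately show ?thesis by simp
qed

primrec heis_cyclic_gen :: "gen \<Rightarrow> int \<times> int \<times> int \<times> int" where
  "heis_cyclic_gen gen_x = (1, 0, 0, 0)"
| "heis_cyclic_gen gen_y = (0, 1, 0, 0)"
| "heis_cyclic_gen gen_z = (0, 0, 1, 0)"
| "heis_cyclic_gen gen_w = (0, 0, 0, 1)"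

text \<open>The defining relations hold for the images of the generators, and \<open>y\<^sup>b x\<^sup>a z\<^sup>c w\<^sup>d\<close> is mapped to
  \<open>(a, b, c, d)\<close>; with the factor \<open>y\<^sup>b\<close> on the left no correction term appears in the third coordinate.\<close>

lemma G4_onto_heis_cyclic:
  assumes p: "1 < p"
  shows "\<exists>\<Psi> \<in> hom (G4 p) (heis_cyclic (int p)). \<Psi> ` carrier (G4 p) = carrier (heis_cyclic (int p))"
proof -
  let ?q = "int p" and ?F = "free_group :: gen word set monoid"
  let ?P = "heis_cyclic ?q"
  have q: "0 < ?q" "1 < ?q" using p by simp_all
  interpret P: group ?P by (rule group_heis_cyclic[OF q(1)])
  interpret F: group ?F by (rule group_free_group)
  let ?\<phi> = heis_cyclic_gen
  have \<phi>: "?\<phi> g \<in> carrier ?P" for g using q by (cases g) (simp_all add: heis_cyclic_carrier)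
  obtain \<Phi> where \<Phi>: "\<Phi> \<in> hom ?F ?P" and gen: "\<And>g. \<Phi> (free_gen g) = ?\<phi> g"
    using free_group_universal[OF P.is_group, of ?\<phi>] \<phi> by blast
  interpret \<Phi>: group_hom ?F ?P \<Phi>
    using \<Phi> by (simp add: group_hom_def group_hom_axioms_def F.is_group P.is_group)
  have gen_closed: "free_gen g \<in> carrier ?F" for g
    by (simp add: free_gen_def free_group_class_closed)
  have comm: "\<Phi> (commutator ?F (free_gen g) (free_gen h)) = commutator ?P (?\<phi> g) (?\<phi> h)" for g h
    by (simp only: \<Phi>.hom_commutator gen_closed gen)
  have pow: "\<Phi> (free_gen g [^]\<^bsub>?F\<^esub> n) = ?\<phi> g [^]\<^bsub>?P\<^esub> n" for g and n :: nat
    by (simp only: \<Phi>.hom_nat_pow gen_closed gen)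
  define R where "R = (let F = ?F; e = \<one>\<^bsub>F\<^esub>;
         x = free_gen gen_x; y = free_gen gen_y; z = free_gen gen_z; w = free_gen gen_w
     in {(x [^]\<^bsub>F\<^esub> p, e), (y [^]\<^bsub>F\<^esub> p, e), (z [^]\<^bsub>F\<^esub> p, e), (w [^]\<^bsub>F\<^esub> p, e),
        (commutator F x y, z),
        (commutator F x z, e), (commutator F x w, e), (commutator F y z, e),
        (commutator F y w, e), (commutator F z w, e)})"
  have "u \<in> carrier ?F \<and> v \<in> carrier ?F \<and> \<Phi> u = \<Phi> v" if "(u, v) \<in> R" for u v
    using that q \<phi>[of gen_x] \<phi>[of gen_y] \<phi>[of gen_z] \<phi>[of gen_w]
    by (auto simp: R_def Let_def gen_closed F.commutator_closed comm pow gen heis_cyclic_pow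
        heis_cyclic_one heis_cyclic_commutator)
  from von_Dyck[OF P.is_group \<Phi> this]
  obtain \<Psi> where \<Psi>: "\<Psi> \<in> hom (presented_group R) ?P"
      and onto: "\<Phi> ` carrier ?F \<subseteq> \<Psi> ` carrier (presented_group R)" by blast
  have "carrier ?P \<subseteq> \<Phi> ` carrier ?F"
  proof
    fix u assume "u \<in> carrier ?P"
    then obtain a b c d :: nat where u: "u = (int a, int b, int c, int d)"
      and abcd: "a < p" "b < p" "c < p" "d < p"
      by (cases u) (auto simp: heis_cyclic_carrier elim!: nonneg_int_cases)
    let ?v = "free_gen gen_y [^]\<^bsub>?F\<^esub> b \<otimes>\<^bsub>?F\<^esub> free_gen gen_x [^]\<^bsub>?F\<^esub> a
      \<otimes>\<^bsub>?F\<^esub> free_gen gen_z [^]\<^bsub>?F\<^esub> c \<otimes>\<^bsub>?F\<^esub> free_gen gen_w [^]\<^bsub>?F\<^esub> d"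
    have "\<Phi> ?v = u"
      using abcd q by (simp add: gen_closed pow heis_cyclic_pow heis_cyclic_mult u)
    moreover have "?v \<in> carrier ?F" by (simp add: gen_closed)
    ultimately show "u \<in> \<Phi> ` carrier ?F" by blast
  qed
  then have "\<Psi> ` carrier (presented_group R) = carrier ?P"
    using onto hom_in_carrier[OF \<Psi>] by blast
  moreover have "presented_group R = G4 p" by (simp add: R_def G4_def Let_def)
  ultimately show ?thesis using \<Psi> by metis
qed

section \<open>Central extensions by a group of order p\<close>

text \<open>The isomorphism \<open>E/N \<cong> G\<^sub>4\<close> is composed with the map of \<open>G\<^sub>4\<close> onto the concrete group of order
  \<open>p\<^sup>4\<close>. Comparing orders makes the composite \<open>\<theta>\<close> bijective, and the two cases of
  \<open>small_degree_dichotomy\<close> are then refuted by two commutator counts: none of the commutators can be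
  non-trivial in the first case, and more than \<open>p\<^sup>2\<close> of them would have to exist in the second.\<close>

theorem theorem6:
  fixes p :: nat
  assumes "Factorial_Ring.prime p" and "odd p"
  shows "\<not> (\<exists>(E :: ('a, 'b) monoid_scheme) N.
            group E \<and> order E = p ^ 5 \<and>
            central_subgroup E N \<and>
            E Mod N \<cong> G4 p \<and>
            exceptional_group E \<and> distinguished_subgroup E N)"
proof
  assume "\<exists>(E :: ('a, 'b) monoid_scheme) N.
            group E \<and> order E = p ^ 5 \<and>
            central_subgroup E N \<and>
            E Mod N \<cong> G4 p \<and>
            exceptional_group E \<and> distinguished_subgroup E N"
  then obtain E :: "('a, 'b) monoid_scheme" and N
    where "group E" and ord: "order E = p ^ 5" and central: "central_subgroup E N"
      and iso: "E Mod N \<cong> G4 p" and dist: "distinguished_subgroup E N" by blast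
  interpret E: group E by fact
  let ?P = "heis_cyclic (int p)" and ?Q = "E Mod N"
  note p = \<open>Factorial_Ring.prime p\<close>
  have p1: "1 < p" using p by (rule prime_gt_1_nat)
  have fin: "finite (carrier E)" and less: "minimal_degree E < minimal_degree ?Q"
    and N_normal: "N \<lhd> E" using dist by (auto simp: distinguished_subgroup_def)
  interpret N: normal N E by (rule N_normal)
  interpret Q: group ?Q by (rule N.factorgroup_is_group)
  interpret P: group ?P using p1 by (intro group_heis_cyclic) simp
  obtain f where f: "f \<in> mon E (sym_group (minimal_degree E))"
    using minimal_degree_attained[OF \<open>group E\<close> fin] by blast
  \<comment> \<open>otherwise \<open>E\<close> and \<open>E/N\<close> would have the same minimal degree\<close>
  have "N \<noteq> {\<one>\<^bsub>E\<^esub>}"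
  proof
    assume "N = {\<one>\<^bsub>E\<^esub>}"
    then have "the_elem \<in> mon ?Q E"
      using E.trivial_factor_iso by (simp add: mon_def iso_def bij_betw_def)
    from minimal_degree_le[OF mon_compose[OF this f]] less show False by simp
  qed
  obtain \<psi> where \<psi>: "\<psi> \<in> iso ?Q (G4 p)" using iso by (auto simp: is_iso_def)
  obtain \<Psi> where \<Psi>: "\<Psi> \<in> hom (G4 p) ?P" "\<Psi> ` carrier (G4 p) = carrier ?P"
    using G4_onto_heis_cyclic[OF p1] by blast
  define \<theta> where "\<theta> = \<Psi> \<circ> \<psi>"
  have \<theta>_hom: "\<theta> \<in> hom ?Q ?P" using \<psi> \<Psi>(1) by (auto simp: \<theta>_def iso_def hom_compose)
  have \<theta>_onto: "\<theta> ` carrier ?Q = carrier ?P"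
    unfolding \<theta>_def image_comp[symmetric] using \<psi> \<Psi>(2) by (simp add: iso_def bij_betw_def)
  have Q_carrier: "carrier ?Q = rcosets\<^bsub>E\<^esub> N" by (simp add: FactGroup_def)
  have Q_fin: "finite (carrier ?Q)" using fin by (simp add: Q_carrier RCOSETS_def)
  have lagr: "card (carrier ?Q) * card N = p ^ 5"
    using E.lagrange[OF N.is_subgroup] ord by (simp add: Q_carrier)
  obtain j where j: "j \<le> 5" "card N = p ^ j"
    using E.card_subgroup_dvd_order[OF N.is_subgroup] ord divides_primepow_nat[OF p] by auto
  have "card N \<noteq> 1"
    using \<open>N \<noteq> {\<one>\<^bsub>E\<^esub>}\<close> N.one_closed by (metis card_1_singletonE singletonD)
  then have "j \<noteq> 0" using j(2) by (intro notI) simp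
  have "card (carrier ?Q) * p ^ j = p ^ (5 - j) * p ^ j"
    using lagr j by (simp flip: power_add)
  then have Q: "card (carrier ?Q) = p ^ (5 - j)" using p1 by simp
  \<comment> \<open>surjectivity of \<open>\<theta>\<close> bounds \<open>|E/N|\<close> from below, non-triviality of \<open>N\<close> from above\<close>
  have "p ^ 4 \<le> card (carrier ?Q)"
    using card_image_le[OF Q_fin, of \<theta>] \<theta>_onto order_heis_cyclic[of p] by (simp add: order_def)
  then have "4 \<le> 5 - j" unfolding Q using p1 power_le_imp_le_exp by blast
  with \<open>j \<noteq> 0\<close> have "j = 1" by simp
  with Q j have card_Q: "card (carrier ?Q) = p ^ 4" and card_N: "card N = p" by simp_all
  have \<theta>_inj: "inj_on \<theta> (carrier ?Q)"
    using \<theta>_onto card_Q order_heis_cyclic[of p] Q_fin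
    by (intro eq_card_imp_inj_on) (simp_all add: order_def)
  have deg: "minimal_degree E < p ^ 2 + p"
  proof -
    obtain g where "g \<in> mon ?P (sym_group (p ^ 2 + p))"
      using heis_cyclic_mon_sym_group[OF p1] by blast
    then have "g \<circ> \<theta> \<in> mon ?Q (sym_group (p ^ 2 + p))"
      using \<theta>_hom \<theta>_inj by (intro mon_compose) (simp add: mon_def)
    from minimal_degree_le[OF this] less show ?thesis by simp
  qed
  define \<pi> where "\<pi> g = \<theta> (N #>\<^bsub>E\<^esub> g)" for g
  have "(\<lambda>g. N #>\<^bsub>E\<^esub> g) \<in> hom E ?Q" by (rule N.r_coset_hom_Mod)
  from hom_compose[OF this \<theta>_hom] interpret \<pi>: group_hom E ?P \<pi>
    by (simp add: group_hom_def group_hom_axioms_def E.is_group P.is_group \<pi>_def[abs_def] comp_def)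
  have \<pi>_onto: "\<exists>g\<in>carrier E. \<pi> g = u" if "u \<in> carrier ?P" for u
  proof -
    have "u \<in> \<theta> ` carrier ?Q" using that by (simp only: \<theta>_onto)
    then obtain C where "C \<in> carrier ?Q" "\<theta> C = u" by (elim imageE) simp
    then show ?thesis by (auto simp: Q_carrier RCOSETS_def \<pi>_def)
  qed
  let ?X = "{commutator E a b | a b. a \<in> carrier E \<and> b \<in> carrier E}"
  let ?Z = "(\<lambda>c. (0, 0, c, 0)) ` {0..<int p} :: (int \<times> int \<times> int \<times> int) set"
  let ?K = "{C \<in> carrier ?Q. \<theta> C \<in> ?Z}"
  from E.small_degree_dichotomy[OF p ord f deg] show False
  proof
    assume triv: "\<forall>x\<in>carrier E. (\<forall>S. subgroup S E \<and> order E = p * card S \<longrightarrow> x \<in> S) \<longrightarrow> x = \<one>\<^bsub>E\<^esub>"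
    have gens: "(1, 0, 0, 0) \<in> carrier ?P" "(0, 1, 0, 0) \<in> carrier ?P"
      using p1 by (simp_all add: heis_cyclic_carrier)
    obtain a b where ab: "a \<in> carrier E" "\<pi> a = (1, 0, 0, 0)" "b \<in> carrier E" "\<pi> b = (0, 1, 0, 0)"
      using gens[THEN \<pi>_onto] by blast
    have "commutator E a b = \<one>\<^bsub>E\<^esub>"
      using triv ab E.commutator_in_index_prime[OF p ord] E.commutator_closed by blast
    then have "commutator ?P (1, 0, 0, 0) (0, 1, 0, 0) = \<one>\<^bsub>?P\<^esub>"
      using ab \<pi>.hom_commutator[of a b] by simp
    then show False using gens p1 by (simp add: heis_cyclic_commutator heis_cyclic_one)
  next
    assume "\<exists>H. subgroup H E \<and> order E = p ^ 2 * card H \<and> (\<forall>k\<in>carrier E.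
      (\<forall>g\<in>carrier E. inv\<^bsub>E\<^esub> g \<otimes>\<^bsub>E\<^esub> k \<otimes>\<^bsub>E\<^esub> g \<in> H) \<longrightarrow> k = \<one>\<^bsub>E\<^esub>)"
    then have many: "p ^ 2 < card ?X"
      using E.core_free_imp_many_commutators[OF p ord central card_N] by blast
    \<comment> \<open>\<open>?K\<close> consists of the at most \<open>p\<close> cosets of \<open>N\<close> that can contain commutators\<close>
    have "?X \<subseteq> \<Union> ?K"
    proof
      fix x assume "x \<in> ?X"
      then obtain a b where ab: "a \<in> carrier E" "b \<in> carrier E" "x = commutator E a b" by blast
      obtain a1 a2 a3 a4 b1 b2 b3 b4
        where "\<pi> a = (a1, a2, a3, a4)" "\<pi> b = (b1, b2, b3, b4)" by (cases "\<pi> a"; cases "\<pi> b")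
      then have "\<pi> x = (0, 0, (a1 * b2 - b1 * a2) mod int p, 0)"
        using ab \<pi>.hom_commutator[of a b] \<pi>.hom_closed[of a] \<pi>.hom_closed[of b] p1
        by (simp add: heis_cyclic_commutator)
      then have "\<theta> (N #>\<^bsub>E\<^esub> x) \<in> ?Z" using p1 by (simp add: \<pi>_def)
      moreover have x: "x \<in> carrier E" using ab by (simp add: E.commutator_closed)
      ultimately have "N #>\<^bsub>E\<^esub> x \<in> ?K" by (auto simp: Q_carrier RCOSETS_def)
      then show "x \<in> \<Union> ?K" using E.rcos_self[OF x N.is_subgroup] by blast
    qed
    moreover have "\<Union> ?K \<subseteq> carrier E"
      using N.rcosets_carrier[OF E.is_group] by (auto simp: Q_carrier)
    ultimately have "card ?X \<le> card (\<Union> ?K)"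
      using fin by (meson card_mono finite_subset)
    also have "\<dots> \<le> sum card ?K" using card_UN_le[of ?K id] Q_fin by simp
    also have "\<dots> = (\<Sum>C\<in>?K. p)"
      using E.card_rcosets_equal[OF _ N.subset] card_N by (intro sum.cong) (auto simp: Q_carrier)
    also have "\<dots> = card ?K * p" by simp
    also have "\<dots> \<le> p * p"
    proof (rule mult_right_mono)
      have "card ?K \<le> card ?Z"
        using \<theta>_inj by (intro card_inj_on_le[of \<theta>]) (auto intro: inj_on_subset)
      also have "card ?Z \<le> p" using card_image_le[of "{0..<int p}"] by simp
      finally show "card ?K \<le> p" .
    qed simp
    finally show False using many by (simp add: power2_eq_square)
  qed
qed

end
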